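(* Let $\mathbb{X},\mathbb{Y},\mathbb{P}$ be finite-dimensional Euclidean spaces, $K:\mathbb{X}\to\mathbb{Y}$ a linear operator, $f:\mathbb{X}\times\mathbb{P}\to\mathbb{R}$ a twice continuously differentiable function such that $f(\cdot,p)$ is convex for every $p\in\mathbb{P}$, and $g:\mathbb{Y}\to\mathbb{R}\cup\{\infty\}$ a proper lower semicontinuous convex function. For $(p,v)\in\mathbb{P}\times\mathbb{Y}$ define $$\widetilde S(p,v):=\{(x,y)\in\mathbb{X}\times\mathbb{Y}\mid 0=\nabla_xf(x,p)+K^*y,\ \ v\in-Kx+\partial g^*(y)\}.$$ Fix $\bar p\in\mathbb{P}$ and $(\bar x,\bar y)\in\widetilde S(\bar p,0)$, and assume that the Robinson constraint qualification $0\in\mathrm{int}\,(K\bar x+\mathrm{Im}\,K-\mathrm{dom}\,g)$ holds. For $(u,v)\in\mathbb{X}\times\mathbb{Y}$ define the linearized solution mapping $$\widehat S(u,v):=\{(x,y)\in\mathbb{X}\times\mathbb{Y}\mid u=\nabla_xf(\bar x,\bar p)+\nabla^2_{xx}f(\bar x,\bar p)(x-\bar x)+K^*y,\ \ v\in-Kx+\partial g^*(y)\}.$$ If $\widehat S$ is isolated calm at $(0,0)$ for $(\bar x,\bar y)$, then $$\mathrm{Ker}\,K^*\cap T_{\partial g(K\bar x)}(\bar y)=\{0\}\quad\text{and}\quad\mathrm{Ker}\,\nabla^2_{xx}f(\bar x,\bar p)\cap K^{-1}\big(T_{\partial g^*(\bar y)}(K\bar x)\big)=\{0\}.\qquad(\star)$$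 If, additionally, $g$ satisfies the primal-dual quadratic growth condition at $K\bar x$ for $\bar y$, then the two conditions in $(\star)$ are sufficient for the isolated calmness of $\widehat S$ at $(0,0)$ for $(\bar x,\bar y)$. Consequently, they are (under this additional assumption) sufficient for the isolated calmness of $\widetilde S$ at $(\bar p,0)$ for $(\bar x,\bar y)$.
   Context: $g^*$ is the Fenchel conjugate of $g$, $\partial$ the convex subdifferential, $K^*$ the adjoint. Tangent cone: $T_\Omega(\bar u):=\{w\mid\exists\,t_k\downarrow0,\ w_k\to w,\ \bar u+t_kw_k\in\Omega\}$ for $\bar u\in\Omega$. Isolated calmness: a set-valued mapping $S$ from a Euclidean space $\mathbb{A}$ to a Euclidean space $\mathbb{B}$ is isolated calm at $\bar a$ for $\bar z\in S(\bar a)$ if there exist $\ell>0$ and neighborhoods $U$ of $\bar z$ and $V$ of $\bar a$ such that $\|z-\bar z\|\le\ell\|a-\bar a\|$ whenever $a\in V$ and $z\in S(a)\cap U$. Quadratic growth condition: a proper lower semicontinuous convex function $\varphi$ satisfies it at $\bar u\in\mathrm{dom}\,\varphi$ for $\bar v\in\partial\varphi(\bar u)$ if there exist $c,\varepsilon>0$ such that $\varphi(u)\ge\varphi(\bar u)+\langle\bar v,u-\bar u\rangle+\frac c2[d(u;(\partial\varphi)^{-1}(\bar v))]^2$ for all $u$ with $\|u-\bar u\|<\varepsilon$, where $d(\cdot;\Omega)$ is the distance to $\Omega$. The function $\varphi$ satisfies the primal-dual quadratic growth condition at $\bar u$ for $\bar v$ if $\varphi$ satisfies the quadratic growth condition at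 $\bar u$ for $\bar v$ and $\varphi^*$ satisfies the quadratic growth condition at $\bar v$ for $\bar u$. *)

theory Defs
  imports "HOL-Analysis.Analysis"
begin

section \<open>Convex analysis of extended-real-valued functions\<close>

definition edom :: "('a \<Rightarrow> ereal) \<Rightarrow> 'a set" where
  "edom \<phi> = {u. \<phi> u < \<infinity>}"

definition proper_fun :: "('a \<Rightarrow> ereal) \<Rightarrow> bool" where
  "proper_fun \<phi> \<longleftrightarrow> (\<forall>u. \<phi> u \<noteq> -\<infinity>) \<and> edom \<phi> \<noteq> {}"

definition lsc_fun :: "('a::topological_space \<Rightarrow> ereal) \<Rightarrow> bool" where
  "lsc_fun \<phi> \<longleftrightarrow> (\<forall>u. \<phi> u \<le> Liminf (at u) \<phi>)"

text \<open>Convexity is convexity of the epigraph, a subset of the product with the reals.\<close>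

definition convex_fun :: "('a::real_vector \<Rightarrow> ereal) \<Rightarrow> bool" where
  "convex_fun \<phi> \<longleftrightarrow> convex {(u, r::real). \<phi> u \<le> ereal r}"

definition fenchel_conjugate :: "('a::real_inner \<Rightarrow> ereal) \<Rightarrow> 'a \<Rightarrow> ereal" where
  "fenchel_conjugate \<phi> v = (SUP u. ereal (v \<bullet> u) - \<phi> u)"

text \<open>The subdifferential is empty at points where \<open>\<phi>\<close> is not finite.\<close>

definition subdiff :: "('a::real_inner \<Rightarrow> ereal) \<Rightarrow> 'a \<Rightarrow> 'a set" where
  "subdiff \<phi> u = {v. \<bar>\<phi> u\<bar> \<noteq> \<infinity> \<and> (\<forall>w. \<phi> u + ereal (v \<bullet> (w - u)) \<le> \<phi> w)}"

definition subdiff_inv :: "('a::real_inner \<Rightarrow> ereal) \<Rightarrow> 'a \<Rightarrow> 'a set" where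
  "subdiff_inv \<phi> v = {u. v \<in> subdiff \<phi> u}"

text \<open>The base point conditions (finiteness and \<open>v \<in> subdiff \<phi> u\<close>) are part of the
  definition; in particular the set in the distance is nonempty, so the library convention
  \<open>infdist u {} = 0\<close> plays no role.\<close>

definition quadratic_growth :: "('a::euclidean_space \<Rightarrow> ereal) \<Rightarrow> 'a \<Rightarrow> 'a \<Rightarrow> bool" where
  "quadratic_growth \<phi> u0 v0 \<longleftrightarrow>
     u0 \<in> edom \<phi> \<and> v0 \<in> subdiff \<phi> u0 \<and>
     (\<exists>c>0. \<exists>\<epsilon>>0. \<forall>u. norm (u - u0) < \<epsilon> \<longrightarrow>
        \<phi> u \<ge> \<phi> u0 + ereal (v0 \<bullet> (u - u0)) + ereal (c / 2 * (infdist u (subdiff_inv \<phi> v0))\<^sup>2))"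

definition primal_dual_quadratic_growth ::
    "('a::euclidean_space \<Rightarrow> ereal) \<Rightarrow> 'a \<Rightarrow> 'a \<Rightarrow> bool" where
  "primal_dual_quadratic_growth \<phi> u0 v0 \<longleftrightarrow>
     quadratic_growth \<phi> u0 v0 \<and> quadratic_growth (fenchel_conjugate \<phi>) v0 u0"


section \<open>Tangent cones and isolated calmness\<close>

text \<open>As usual in variational analysis, \<open>t\<^sub>k \<down> 0\<close> means that \<open>t\<^sub>k\<close> tends to \<open>0\<close> through
  positive values; requiring monotonicity as well gives the same cone, by passing to
  subsequences.\<close>

definition tangent_cone :: "'a::real_normed_vector set \<Rightarrow> 'a \<Rightarrow> 'a set" where
  "tangent_cone \<Omega> u = {w. \<exists>(t::nat \<Rightarrow> real) (\<omega>::nat \<Rightarrow> 'a).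
     (\<forall>k. t k > 0) \<and> t \<longlonglongrightarrow> 0 \<and> \<omega> \<longlonglongrightarrow> w \<and> (\<forall>k. u + t k *\<^sub>R \<omega> k \<in> \<Omega>)}"

definition isolated_calm ::
    "('a::euclidean_space \<Rightarrow> 'b::euclidean_space set) \<Rightarrow> 'a \<Rightarrow> 'b \<Rightarrow> bool" where
  "isolated_calm S a0 z0 \<longleftrightarrow>
     z0 \<in> S a0 \<and>
     (\<exists>l>0. \<exists>U V. open U \<and> z0 \<in> U \<and> open V \<and> a0 \<in> V \<and>
        (\<forall>a\<in>V. \<forall>z\<in>S a \<inter> U. norm (z - z0) \<le> l * norm (a - a0)))"


section \<open>Derivatives and solution mappings\<close>

definition gradient :: "('a::euclidean_space \<Rightarrow> real) \<Rightarrow> 'a \<Rightarrow> 'a" where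
  "gradient h x = (THE D. GDERIV h x :> D)"

text \<open>\<open>H z\<close> is the Hessian at \<open>z\<close> viewed as a linear operator; its continuity is with
  respect to the operator norm.\<close>

definition twice_cont_differentiable :: "('a::euclidean_space \<Rightarrow> real) \<Rightarrow> bool" where
  "twice_cont_differentiable h \<longleftrightarrow>
     (\<exists>(G::'a \<Rightarrow> 'a) (H::'a \<Rightarrow> 'a \<Rightarrow>\<^sub>L 'a).
        (\<forall>z. GDERIV h z :> G z) \<and>
        (\<forall>z. (G has_derivative blinfun_apply (H z)) (at z)) \<and>
        continuous_on UNIV H)"

definition grad_x ::
    "('x::euclidean_space \<times> 'p::euclidean_space \<Rightarrow> real) \<Rightarrow> 'x \<Rightarrow> 'p \<Rightarrow> 'x" where
  "grad_x f x p = gradient (\<lambda>x'. f (x', p)) x"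

definition hess_xx ::
    "('x::euclidean_space \<times> 'p::euclidean_space \<Rightarrow> real) \<Rightarrow> 'x \<Rightarrow> 'p \<Rightarrow> 'x \<Rightarrow> 'x" where
  "hess_xx f x p = frechet_derivative (\<lambda>x'. grad_x f x' p) (at x)"

definition S_tilde ::
    "('x::euclidean_space \<times> 'p::euclidean_space \<Rightarrow> real) \<Rightarrow>
     ('x \<Rightarrow> 'y::euclidean_space) \<Rightarrow> ('y \<Rightarrow> ereal) \<Rightarrow> 'p \<times> 'y \<Rightarrow> ('x \<times> 'y) set" where
  "S_tilde f K g = (\<lambda>(p, v). {(x, y).
     0 = grad_x f x p + adjoint K y \<and>
     v \<in> {- K x + z | z. z \<in> subdiff (fenchel_conjugate g) y}})"

definition S_hat ::
    "('x::euclidean_space \<times> 'p::euclidean_space \<Rightarrow> real) \<Rightarrow>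
     ('x \<Rightarrow> 'y::euclidean_space) \<Rightarrow> ('y \<Rightarrow> ereal) \<Rightarrow> 'x \<Rightarrow> 'p \<Rightarrow>
     'x \<times> 'y \<Rightarrow> ('x \<times> 'y) set" where
  "S_hat f K g x0 p0 = (\<lambda>(u, v). {(x, y).
     u = grad_x f x0 p0 + hess_xx f x0 p0 (x - x0) + adjoint K y \<and>
     v \<in> {- K x + z | z. z \<in> subdiff (fenchel_conjugate g) y}})"

definition robinson_cq ::
    "('x::euclidean_space \<Rightarrow> 'y::euclidean_space) \<Rightarrow> ('y \<Rightarrow> ereal) \<Rightarrow> 'x \<Rightarrow> bool" where
  "robinson_cq K g x0 \<longleftrightarrow> 0 \<in> interior {K x0 + K x - z | x z. z \<in> edom g}"

end

theory Submission
  imports Defs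
begin

text \<open>
  Isolated calmness is a tangential property: \<open>S\<close> is isolated calm at \<open>a0\<close> for
  \<open>z0\<close> exactly when the tangent cone to its graph at \<open>(a0, z0)\<close> contains no vector
  \<open>(0, \<zeta>)\<close> with \<open>\<zeta> \<noteq> 0\<close>
  (\<open>isolated_calm_tangent_eq_0\<close>, \<open>isolated_calm_if_tangent\<close>). Every claim thus
  becomes a statement about first-order perturbations \<open>(\<xi>, \<eta>)\<close> of the solution
  \<open>(x0, y0)\<close>. Write \<open>A\<close> for the Hessian of \<open>f(\<cdot>, p0)\<close> at
  \<open>x0\<close>. By the biconjugate theorem \<open>v \<in> - K x + \<partial>g\<^sup>*(y)\<close> says
  that \<open>y \<in> \<partial>g(K x + v)\<close>.

  Necessity is seen by moving one variable only. A direction \<open>\<eta>\<close> in \<open>Ker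
  K\<^sup>*\<close> tangent to \<open>\<partial>g(K x0)\<close> is followed with \<open>x\<close> held at
  \<open>x0\<close>, and a direction \<open>\<xi>\<close> in \<open>Ker A\<close> with \<open>K \<xi>\<close>
  tangent to \<open>\<partial>g\<^sup>*(y0)\<close> is followed with \<open>y\<close> held at
  \<open>y0\<close>; in both cases the residual of the linearized system is of smaller order than the step, so
  the direction violates the tangential criterion unless it is zero.

  For sufficiency, a vector \<open>((0, 0), (\<xi>, \<eta>))\<close> tangent to the graph of
  \<open>S_hat\<close> satisfies \<open>A \<xi> + K\<^sup>* \<eta> = 0\<close>, and \<open>(K \<xi>,
  \<eta>)\<close> is tangent to the graph of \<open>\<partial>g\<close>. For \<open>v \<in>
  \<partial>\<phi>(u)\<close> near the base point, quadratic growth bounds the squared distance of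
  \<open>u\<close> to \<open>(\<partial>\<phi>)\<^sup>-\<^sup>1(v0)\<close> by a multiple of \<open>\<langle>v
  - v0, u - u0\<rangle>\<close>. Hence tangent vectors to the graph have nonnegative inner product, and when
  that product vanishes the first component is tangent to
  \<open>(\<partial>\<phi>)\<^sup>-\<^sup>1(v0)\<close> (\<open>quadratic_growth_tangent\<close>). This is
  used for \<open>g\<close> and for \<open>g\<^sup>*\<close>. But \<open>\<langle>K \<xi>, \<eta>\<rangle> = -
  \<langle>\<xi>, A \<xi>\<rangle> \<le> 0\<close>, so both inner products vanish. As \<open>A\<close> is the
  Hessian of a convex function, \<open>\<langle>\<xi>, A \<xi>\<rangle> = 0\<close> implies \<open>A \<xi> =
  0\<close> (\<open>convex_hessian_kernel\<close>), whence also \<open>K\<^sup>* \<eta> = 0\<close>, and the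
  two conditions \<open>star\<close> force \<open>\<xi> = 0\<close> and \<open>\<eta> = 0\<close>.

  Finally, the tangential criterion passes from the linearized map to the original one, because a tangent
  vector to the graph of \<open>S_tilde\<close> whose parameter component is zero is also such a tangent
  vector for \<open>S_hat\<close>: the two residuals differ by a quantity of smaller order than the step
  (\<open>tangent_S_tilde_S_hat\<close>).
\<close>

section \<open>Isolated calmness through tangent vectors to the graph\<close>

definition gph :: "('a \<Rightarrow> 'b set) \<Rightarrow> ('a \<times> 'b) set" where
  "gph S = {(a, z). z \<in> S a}"

lemma tangent_coneI:
  assumes "\<And>k::nat. t k > 0" "t \<longlonglongrightarrow> 0" "\<omega> \<longlonglongrightarrow> w" "\<And>k. u + t k *\<^sub>R \<omega> k \<in> \<Omega>"
  shows "w \<in> tangent_cone \<Omega> u"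
  using assms unfolding tangent_cone_def by blast

lemma tangent_coneE:
  assumes "w \<in> tangent_cone \<Omega> u"
  obtains t :: "nat \<Rightarrow> real" and \<omega>
  where "\<And>k. t k > 0" "t \<longlonglongrightarrow> 0" "\<omega> \<longlonglongrightarrow> w" "\<And>k. u + t k *\<^sub>R \<omega> k \<in> \<Omega>"
  using assms unfolding tangent_cone_def by blast

lemma zero_in_tangent_cone:
  assumes "u \<in> \<Omega>"
  shows "0 \<in> tangent_cone \<Omega> u"
  by (rule tangent_coneI[where t = "\<lambda>k. inverse (real (Suc k))" and \<omega> = "\<lambda>_. 0"])
     (use assms LIMSEQ_inverse_real_of_nat in auto)

lemma tangent_gphI:
  assumes "\<And>k::nat. t k > 0" "t \<longlonglongrightarrow> 0" "\<alpha> \<longlonglongrightarrow> a" "\<zeta> \<longlonglongrightarrow> z"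
    and "\<And>k. z0 + t k *\<^sub>R \<zeta> k \<in> S (a0 + t k *\<^sub>R \<alpha> k)"
  shows "(a, z) \<in> tangent_cone (gph S) (a0, z0)"
proof (rule tangent_coneI[where t = t and \<omega> = "\<lambda>k. (\<alpha> k, \<zeta> k)"])
  show "(\<lambda>k. (\<alpha> k, \<zeta> k)) \<longlonglongrightarrow> (a, z)"
    by (intro tendsto_Pair assms)
qed (use assms in \<open>auto simp: gph_def\<close>)

lemma tangent_gphE:
  assumes "(a, z) \<in> tangent_cone (gph S) (a0, z0)"
  obtains t :: "nat \<Rightarrow> real" and \<alpha> \<zeta>
  where "\<And>k. t k > 0" "t \<longlonglongrightarrow> 0" "\<alpha> \<longlonglongrightarrow> a" "\<zeta> \<longlonglongrightarrow> z"
    "\<And>k. z0 + t k *\<^sub>R \<zeta> k \<in> S (a0 + t k *\<^sub>R \<alpha> k)"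
proof -
  from assms obtain t :: "nat \<Rightarrow> real" and \<omega>
    where t: "\<And>k. t k > 0" "t \<longlonglongrightarrow> 0" "\<omega> \<longlonglongrightarrow> (a, z)" "\<And>k. (a0, z0) + t k *\<^sub>R \<omega> k \<in> gph S"
    by (rule tangent_coneE) blast
  show ?thesis
  proof (rule that[of t "\<lambda>k. fst (\<omega> k)" "\<lambda>k. snd (\<omega> k)"])
    show "(\<lambda>k. fst (\<omega> k)) \<longlonglongrightarrow> a" "(\<lambda>k. snd (\<omega> k)) \<longlonglongrightarrow> z"
      using tendsto_fst[OF t(3)] tendsto_snd[OF t(3)] by simp_all
    show "z0 + t k *\<^sub>R snd (\<omega> k) \<in> S (a0 + t k *\<^sub>R fst (\<omega> k))" for k
      using t(4)[of k] by (cases "\<omega> k") (simp add: gph_def)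
  qed (use t in auto)
qed

lemma isolated_calm_tangent_eq_0:
  fixes S :: "'a::euclidean_space \<Rightarrow> 'b::euclidean_space set"
  assumes "isolated_calm S a0 z0" "(0, \<zeta>) \<in> tangent_cone (gph S) (a0, z0)"
  shows "\<zeta> = 0"
proof -
  obtain l U V where l: "l > 0" and U: "open U" "z0 \<in> U" and V: "open V" "a0 \<in> V"
    and calm: "\<And>a z. a \<in> V \<Longrightarrow> z \<in> S a \<inter> U \<Longrightarrow> norm (z - z0) \<le> l * norm (a - a0)"
    using assms(1) unfolding isolated_calm_def by metis
  obtain t :: "nat \<Rightarrow> real" and \<alpha> Z
    where t: "\<And>k. t k > 0" "t \<longlonglongrightarrow> 0" and \<alpha>: "\<alpha> \<longlonglongrightarrow> 0" and Z: "Z \<longlonglongrightarrow> \<zeta>"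
      and mem: "\<And>k. z0 + t k *\<^sub>R Z k \<in> S (a0 + t k *\<^sub>R \<alpha> k)"
    using assms(2) by (rule tangent_gphE) blast
  have "(\<lambda>k. a0 + t k *\<^sub>R \<alpha> k) \<longlonglongrightarrow> a0 + 0 *\<^sub>R 0" "(\<lambda>k. z0 + t k *\<^sub>R Z k) \<longlonglongrightarrow> z0 + 0 *\<^sub>R \<zeta>"
    by (intro tendsto_intros t \<alpha> Z)+
  then have "\<forall>\<^sub>F k in sequentially. a0 + t k *\<^sub>R \<alpha> k \<in> V"
    "\<forall>\<^sub>F k in sequentially. z0 + t k *\<^sub>R Z k \<in> U"
    using U V by (auto dest: topological_tendstoD)
  then have "\<forall>\<^sub>F k in sequentially. norm (Z k) \<le> l * norm (\<alpha> k)"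
  proof eventually_elim
    case (elim k)
    have "t k * norm (Z k) \<le> t k * (l * norm (\<alpha> k))"
      using calm[of "a0 + t k *\<^sub>R \<alpha> k" "z0 + t k *\<^sub>R Z k"] elim mem[of k] t(1)[of k]
      by (simp add: algebra_simps)
    then show ?case
      using t(1)[of k] by simp
  qed
  moreover have "(\<lambda>k. norm (Z k)) \<longlonglongrightarrow> norm \<zeta>" "(\<lambda>k. l * norm (\<alpha> k)) \<longlonglongrightarrow> l * norm (0::'a)"
    by (intro tendsto_intros \<alpha> Z)+
  ultimately have "norm \<zeta> \<le> l * norm (0::'a)"
    by (intro tendsto_le[OF sequentially_bot]) auto
  then show ?thesis
    by simp
qed

text \<open>
  If isolated calmness fails there are points of the graph converging to the base point whose
  displacement in \<open>z\<close> dominates the one in \<open>a\<close>. Scaling by the former, a convergent subsequence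
  of the normalized displacements gives a tangent vector \<open>(0, \<zeta>)\<close> with \<open>\<zeta>\<close> of norm one.
\<close>

lemma isolated_calm_if_tangent:
  fixes S :: "'a::euclidean_space \<Rightarrow> 'b::euclidean_space set"
  assumes z0: "z0 \<in> S a0"
    and tan: "\<And>\<zeta>. (0, \<zeta>) \<in> tangent_cone (gph S) (a0, z0) \<Longrightarrow> \<zeta> = 0"
  shows "isolated_calm S a0 z0"
proof (rule ccontr)
  assume neg: "\<not> isolated_calm S a0 z0"
  have "\<exists>a z. dist a0 a < inverse (Suc n) \<and> dist z0 z < inverse (Suc n) \<and> z \<in> S a \<and>
      real (Suc n) * norm (a - a0) < norm (z - z0)" for n
  proof (rule ccontr)
    assume "\<nexists>a z. dist a0 a < inverse (Suc n) \<and> dist z0 z < inverse (Suc n) \<and> z \<in> S a \<and>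
      real (Suc n) * norm (a - a0) < norm (z - z0)"
    then have "\<forall>a\<in>ball a0 (inverse (Suc n)). \<forall>z\<in>S a \<inter> ball z0 (inverse (Suc n)).
        norm (z - z0) \<le> real (Suc n) * norm (a - a0)"
      by (metis IntE mem_ball not_less)
    moreover have "open (ball z0 (inverse (Suc n)))" "z0 \<in> ball z0 (inverse (Suc n))"
      "open (ball a0 (inverse (Suc n)))" "a0 \<in> ball a0 (inverse (Suc n))" "real (Suc n) > 0"
      by (auto simp del: of_nat_Suc)
    ultimately have "isolated_calm S a0 z0"
      unfolding isolated_calm_def using z0 by blast
    with neg show False ..
  qed
  then obtain a z where az: "\<And>n. dist a0 (a n) < inverse (Suc n)"
      "\<And>n. dist z0 (z n) < inverse (Suc n)" "\<And>n. z n \<in> S (a n)"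
      "\<And>n. real (Suc n) * norm (a n - a0) < norm (z n - z0)"
    by metis
  define s where "s n = norm (z n - z0)" for n
  have s: "s n > 0" for n
    using az(4)[of n] unfolding s_def
    by (meson le_less_trans mult_nonneg_nonneg norm_ge_zero of_nat_0_le_iff)
  have s0: "s \<longlonglongrightarrow> 0"
  proof (rule tendsto_sandwich[OF _ _ tendsto_const LIMSEQ_inverse_real_of_nat])
    show "\<forall>\<^sub>F n in sequentially. s n \<le> inverse (real (Suc n))"
      using az(2) by (intro always_eventually allI) (simp add: s_def dist_norm norm_minus_commute less_imp_le)
  qed (use s in \<open>auto intro!: always_eventually less_imp_le\<close>)
  define \<zeta> where "\<zeta> n = (z n - z0) /\<^sub>R s n" for n
  have "\<forall>n. \<zeta> n \<in> sphere 0 1"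
    using s by (auto simp: \<zeta>_def s_def)
  then obtain \<zeta>' r where \<zeta>': "\<zeta>' \<in> sphere 0 1" and r: "strict_mono (r :: nat \<Rightarrow> nat)"
      and lim: "(\<zeta> \<circ> r) \<longlonglongrightarrow> \<zeta>'"
    using seq_compactE[OF compact_imp_seq_compact[OF compact_sphere[of "0::'b" 1]]] by metis
  define \<alpha> where "\<alpha> n = (a n - a0) /\<^sub>R s n" for n
  have \<alpha>0: "\<alpha> \<longlonglongrightarrow> 0"
  proof (rule Lim_null_comparison[OF _ LIMSEQ_inverse_real_of_nat])
    show "\<forall>\<^sub>F n in sequentially. norm (\<alpha> n) \<le> inverse (real (Suc n))"
    proof (intro always_eventually allI)
      fix n
      have "real (Suc n) * norm (a n - a0) \<le> s n"
        using az(4)[of n] by (simp add: s_def)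
      then show "norm (\<alpha> n) \<le> inverse (real (Suc n))"
        using s[of n] by (simp add: \<alpha>_def divide_simps mult.commute del: of_nat_Suc)
    qed
  qed
  have "(0, \<zeta>') \<in> tangent_cone (gph S) (a0, z0)"
  proof (rule tangent_gphI[where t = "s \<circ> r" and \<alpha> = "\<alpha> \<circ> r" and \<zeta> = "\<zeta> \<circ> r"])
    show "(s \<circ> r) \<longlonglongrightarrow> 0" "(\<alpha> \<circ> r) \<longlonglongrightarrow> 0"
      by (intro LIMSEQ_subseq_LIMSEQ s0 \<alpha>0 r)+
    show "z0 + (s \<circ> r) k *\<^sub>R (\<zeta> \<circ> r) k \<in> S (a0 + (s \<circ> r) k *\<^sub>R (\<alpha> \<circ> r) k)" for k
      using az(3)[of "r k"] s[of "r k"] by (simp add: \<zeta>_def \<alpha>_def)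
  qed (use s lim in auto)
  from tan[OF this] \<zeta>' show False
    by simp
qed

section \<open>Subgradients of a convex function and of its conjugate\<close>

lemma closed_epigraph:
  fixes \<phi> :: "'a::t2_space \<Rightarrow> ereal"
  assumes "lsc_fun \<phi>"
  shows "closed {(u, r::real). \<phi> u \<le> ereal r}"
proof -
  have "open (- {(u, r::real). \<phi> u \<le> ereal r})"
  proof (subst open_prod_def, intro ballI)
    fix p assume "p \<in> - {(u, r::real). \<phi> u \<le> ereal r}"
    then obtain u r where p: "p = (u, r)" "\<not> \<phi> u \<le> ereal r"
      by (cases p) auto
    then obtain q where q: "ereal r < ereal q" "ereal q < \<phi> u"
      using ereal_dense2[of "ereal r" "\<phi> u"] by (auto simp: not_le)
    then have "ereal q < Liminf (at u) \<phi>"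
      using assms unfolding lsc_fun_def by (meson less_le_trans)
    then have "\<forall>\<^sub>F w in nhds u. ereal q < \<phi> w"
      using q(2) by (auto simp: eventually_nhds_conv_at dest: less_LiminfD)
    then obtain W where W: "open W" "u \<in> W" "\<And>w. w \<in> W \<Longrightarrow> ereal q < \<phi> w"
      unfolding eventually_nhds by blast
    have "W \<times> {..<q} \<subseteq> - {(u, r::real). \<phi> u \<le> ereal r}"
    proof safe
      fix w s assume "w \<in> W" "s < q" "\<phi> w \<le> ereal s"
      then show False
        using W(3)[of w] by (meson ereal_less_eq(3) leD less_imp_le order_trans)
    qed
    then show "\<exists>A B. open A \<and> open B \<and> p \<in> A \<times> B \<and>
        A \<times> B \<subseteq> - {(u, r::real). \<phi> u \<le> ereal r}"
      using W q(1) p(1) by (intro exI[of _ W] exI[of _ "{..<q}"]) auto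
  qed
  then show ?thesis
    by (simp add: closed_def)
qed

lemma subdiff_finite:
  assumes "v \<in> subdiff \<phi> u"
  obtains r where "\<phi> u = ereal r"
  using assms unfolding subdiff_def by (cases "\<phi> u") auto

lemma fenchel_young: "ereal (v \<bullet> u) - \<phi> u \<le> fenchel_conjugate \<phi> v"
  unfolding fenchel_conjugate_def by (rule SUP_upper) simp

lemma fenchel_conjugate_subgradient:
  assumes "v \<in> subdiff \<phi> u"
  shows "fenchel_conjugate \<phi> v = ereal (v \<bullet> u) - \<phi> u"
proof (rule antisym[OF _ fenchel_young])
  obtain r where r: "\<phi> u = ereal r"
    using assms by (rule subdiff_finite)
  have "ereal (v \<bullet> w) - \<phi> w \<le> ereal (v \<bullet> u - r)" for w
  proof -
    have "\<phi> u + ereal (v \<bullet> (w - u)) \<le> \<phi> w"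
      using assms unfolding subdiff_def by blast
    then show ?thesis
      using r by (cases "\<phi> w") (auto simp: inner_diff_right)
  qed
  then show "fenchel_conjugate \<phi> v \<le> ereal (v \<bullet> u) - \<phi> u"
    unfolding fenchel_conjugate_def r by (intro SUP_least) simp
qed

lemma subdiff_imp_subdiff_conjugate:
  assumes "v \<in> subdiff \<phi> u"
  shows "u \<in> subdiff (fenchel_conjugate \<phi>) v"
proof -
  obtain r where r: "\<phi> u = ereal r"
    using assms by (rule subdiff_finite)
  have "fenchel_conjugate \<phi> v + ereal (u \<bullet> (w - v)) \<le> fenchel_conjugate \<phi> w" for w
    using fenchel_young[of w u \<phi>] fenchel_conjugate_subgradient[OF assms]
    by (simp add: r inner_diff_right inner_commute algebra_simps)
  then show ?thesis
    unfolding subdiff_def using fenchel_conjugate_subgradient[OF assms] r by simp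
qed

text \<open>
  This is the biconjugate theorem at a point where the conjugate has a subgradient. If the point
  \<open>(u, \<langle>v, u\<rangle> - \<phi>\<^sup>*(v))\<close> lay strictly below the epigraph, it could be separated from it by a
  hyperplane with normal \<open>(a, \<beta>)\<close>, \<open>\<beta> \<ge> 0\<close>. Adding the separating inequality to the affine
  minorant with slope \<open>v\<close> gives a minorant that is normalizable even when \<open>\<beta> = 0\<close>, and its slope
  \<open>(v - a) / (1 + \<beta>)\<close> contradicts the subgradient inequality for the conjugate.
\<close>

lemma subdiff_conjugate_imp_subdiff:
  fixes \<phi> :: "'a::euclidean_space \<Rightarrow> ereal"
  assumes \<phi>: "proper_fun \<phi>" "lsc_fun \<phi>" "convex_fun \<phi>"
    and u: "u \<in> subdiff (fenchel_conjugate \<phi>) v"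
  shows "v \<in> subdiff \<phi> u"
proof -
  let ?E = "{(w, s::real). \<phi> w \<le> ereal s}"
  obtain q where q: "fenchel_conjugate \<phi> v = ereal q"
    using u by (rule subdiff_finite)
  have not_minf: "\<phi> w \<noteq> -\<infinity>" for w
    using \<phi>(1) by (simp add: proper_fun_def)
  have minorant: "v \<bullet> w - s \<le> q" if "\<phi> w \<le> ereal s" for w s
    using fenchel_young[of v w \<phi>] that q not_minf[of w] by (cases "\<phi> w") auto
  have le: "\<phi> u \<le> ereal (v \<bullet> u - q)"
  proof (rule ccontr)
    assume "\<not> \<phi> u \<le> ereal (v \<bullet> u - q)"
    then have "(u, v \<bullet> u - q) \<notin> ?E"
      by simp
    moreover have "convex ?E" "closed ?E"
      using \<phi> closed_epigraph by (auto simp: convex_fun_def)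
    ultimately obtain N c where N: "N \<bullet> (u, v \<bullet> u - q) < c" "\<And>x. x \<in> ?E \<Longrightarrow> c < N \<bullet> x"
      using separating_hyperplane_closed_point[of ?E "(u, v \<bullet> u - q)"] by blast
    obtain a \<beta> where ab: "N = (a, \<beta>)"
      by (cases N)
    have below: "a \<bullet> u + \<beta> * (v \<bullet> u - q) < c"
      using N(1) by (simp add: ab)
    have above: "c < a \<bullet> w + \<beta> * s" if "\<phi> w \<le> ereal s" for w s
      using N(2)[of "(w, s)"] that by (simp add: ab)
    obtain w0 s0 where w0: "\<phi> w0 \<le> ereal s0"
    proof -
      from \<phi>(1) obtain w where "\<phi> w < \<infinity>"
        unfolding proper_fun_def edom_def by blast
      then show ?thesis
        using not_minf[of w] that[of w] by (cases "\<phi> w") auto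
    qed
    have \<beta>: "\<beta> \<ge> 0"
    proof (rule ccontr)
      assume neg: "\<not> \<beta> \<ge> 0"
      \<comment> \<open>The epigraph is unbounded upwards, and a negative \<open>\<beta>\<close> would drive the functional to
        \<open>-\<infinity>\<close> on it.\<close>
      define s where "s = max s0 ((c - a \<bullet> w0) / \<beta>)"
      have "\<phi> w0 \<le> ereal s"
        using w0 by (rule order_trans) (simp add: s_def)
      from above[OF this] have "c - a \<bullet> w0 < \<beta> * s"
        by simp
      moreover have "\<beta> * s \<le> \<beta> * ((c - a \<bullet> w0) / \<beta>)"
        using neg by (intro mult_left_mono_neg) (auto simp: s_def)
      ultimately show False
        using neg by simp
    qed
    define y where "y = (v - a) /\<^sub>R (1 + \<beta>)"
    have y: "(1 + \<beta>) * (y \<bullet> w) = v \<bullet> w - a \<bullet> w" for w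
      using \<beta> by (simp add: y_def inner_diff_left)
    have "ereal (y \<bullet> w) - \<phi> w \<le> ereal ((q - c) / (1 + \<beta>))" for w
    proof (cases "\<phi> w")
      case (real s)
      have "v \<bullet> w - s \<le> q" "c < a \<bullet> w + \<beta> * s"
        using minorant[of w s] above[of w s] real by auto
      then have "(1 + \<beta>) * (y \<bullet> w - s) \<le> q - c"
        unfolding right_diff_distrib y by (simp add: algebra_simps)
      then show ?thesis
        using \<beta> real by (simp add: field_simps)
    qed (use not_minf[of w] in auto)
    then have "fenchel_conjugate \<phi> y \<le> ereal ((q - c) / (1 + \<beta>))"
      unfolding fenchel_conjugate_def by (rule SUP_least)
    moreover have "fenchel_conjugate \<phi> v + ereal (u \<bullet> (y - v)) \<le> fenchel_conjugate \<phi> y"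
      using u unfolding subdiff_def by blast
    ultimately have "ereal q + ereal (u \<bullet> (y - v)) \<le> ereal ((q - c) / (1 + \<beta>))"
      unfolding q by (rule order_trans[rotated])
    then have "(1 + \<beta>) * (q + u \<bullet> (y - v)) \<le> q - c"
      using \<beta> by (simp add: field_simps)
    moreover have "(1 + \<beta>) * (q + u \<bullet> (y - v)) = (1 + \<beta>) * q + (v \<bullet> u - a \<bullet> u) - (1 + \<beta>) * (v \<bullet> u)"
      unfolding y[symmetric] by (simp add: inner_diff_right inner_commute algebra_simps)
    ultimately show False
      using below by (simp add: algebra_simps)
  qed
  then obtain r where r: "\<phi> u = ereal r" "r \<le> v \<bullet> u - q"
    using not_minf[of u] by (cases "\<phi> u") auto
  have "\<phi> u + ereal (v \<bullet> (w - u)) \<le> \<phi> w" for w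
    using minorant[of w] r not_minf[of w] by (cases "\<phi> w") (fastforce simp: inner_diff_right)+
  then show ?thesis
    unfolding subdiff_def using r by simp
qed

lemma subdiff_conjugate_iff:
  fixes \<phi> :: "'a::euclidean_space \<Rightarrow> ereal"
  assumes "proper_fun \<phi>" "lsc_fun \<phi>" "convex_fun \<phi>"
  shows "u \<in> subdiff (fenchel_conjugate \<phi>) v \<longleftrightarrow> v \<in> subdiff \<phi> u"
  using subdiff_conjugate_imp_subdiff[OF assms] subdiff_imp_subdiff_conjugate by metis

section \<open>Quadratic growth and tangent vectors to the graph of the subdifferential\<close>

lemma tangent_cone_if_infdist:
  fixes \<Omega> :: "'a::real_normed_vector set"
  assumes ne: "\<Omega> \<noteq> {}" and t: "\<And>k::nat. t k > 0" "t \<longlonglongrightarrow> 0" and \<omega>: "\<omega> \<longlonglongrightarrow> w"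
    and d: "(\<lambda>k. infdist (u + t k *\<^sub>R \<omega> k) \<Omega> / t k) \<longlonglongrightarrow> 0"
  shows "w \<in> tangent_cone \<Omega> u"
proof -
  let ?d = "\<lambda>k. infdist (u + t k *\<^sub>R \<omega> k) \<Omega>"
  \<comment> \<open>The infimum need not be attained; an error of order \<open>t k / k\<close> is harmless.\<close>
  have "\<exists>q\<in>\<Omega>. dist (u + t k *\<^sub>R \<omega> k) q < ?d k + t k * inverse (Suc k)" for k
  proof -
    have "?d k < ?d k + t k * inverse (Suc k)"
      using t(1)[of k] by simp
    then show ?thesis
      unfolding infdist_notempty[OF ne] using ne
      by (subst (asm) cINF_less_iff) auto
  qed
  then obtain q where q: "\<And>k. q k \<in> \<Omega>"
      "\<And>k. dist (u + t k *\<^sub>R \<omega> k) (q k) < ?d k + t k * inverse (Suc k)"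
    by metis
  define \<omega>' where "\<omega>' k = (q k - u) /\<^sub>R t k" for k
  have bound: "norm (\<omega>' k - \<omega> k) \<le> ?d k / t k + inverse (Suc k)" for k
  proof -
    have "t k *\<^sub>R (\<omega>' k - \<omega> k) = q k - (u + t k *\<^sub>R \<omega> k)"
      using t(1)[of k] by (simp add: \<omega>'_def scaleR_right_diff_distrib algebra_simps)
    then have "t k * norm (\<omega>' k - \<omega> k) = dist (u + t k *\<^sub>R \<omega> k) (q k)"
      using t(1)[of k] by (metis abs_of_pos dist_commute dist_norm norm_scaleR)
    then have "t k * norm (\<omega>' k - \<omega> k) \<le> t k * (?d k / t k + inverse (Suc k))"
      using q(2)[of k] t(1)[of k] by (simp add: distrib_left del: of_nat_Suc)
    then show ?thesis
      using t(1)[of k] by (simp only: mult_le_cancel_left_pos)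
  qed
  have "(\<lambda>k. \<omega>' k - \<omega> k) \<longlonglongrightarrow> 0"
  proof (rule Lim_null_comparison)
    show "\<forall>\<^sub>F k in sequentially. norm (\<omega>' k - \<omega> k) \<le> ?d k / t k + inverse (real (Suc k))"
      using bound by (intro always_eventually allI)
    show "(\<lambda>k. ?d k / t k + inverse (real (Suc k))) \<longlonglongrightarrow> 0"
      using tendsto_add[OF d LIMSEQ_inverse_real_of_nat] by simp
  qed
  then have "(\<lambda>k. (\<omega>' k - \<omega> k) + \<omega> k) \<longlonglongrightarrow> 0 + w"
    by (rule tendsto_add[OF _ \<omega>])
  then have "\<omega>' \<longlonglongrightarrow> w"
    by simp
  then show ?thesis
  proof (rule tangent_coneI[OF t])
    show "u + t k *\<^sub>R \<omega>' k \<in> \<Omega>" for k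
      using t(1)[of k] q(1)[of k] by (simp add: \<omega>'_def)
  qed
qed

text \<open>
  Adding the growth inequality at \<open>u\<close> to the subgradient inequality from \<open>u\<close> back to \<open>u0\<close> cancels
  the function values.
\<close>

lemma quadratic_growth_gap:
  assumes "quadratic_growth \<phi> u0 v0"
  obtains c \<epsilon> where "c > 0" "\<epsilon> > 0"
    "\<And>u v. norm (u - u0) < \<epsilon> \<Longrightarrow> v \<in> subdiff \<phi> u \<Longrightarrow>
       c / 2 * (infdist u (subdiff_inv \<phi> v0))\<^sup>2 \<le> (u - u0) \<bullet> (v - v0)"
proof -
  obtain c \<epsilon> where c: "c > 0" "\<epsilon> > 0" and
    growth: "\<And>u. norm (u - u0) < \<epsilon> \<Longrightarrow>
        \<phi> u0 + ereal (v0 \<bullet> (u - u0)) + ereal (c / 2 * (infdist u (subdiff_inv \<phi> v0))\<^sup>2) \<le> \<phi> u"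
    using assms unfolding quadratic_growth_def by blast
  obtain r0 where r0: "\<phi> u0 = ereal r0"
    using assms unfolding quadratic_growth_def by (blast elim: subdiff_finite)
  show ?thesis
  proof (rule that[OF c])
    fix u v assume u: "norm (u - u0) < \<epsilon>" and v: "v \<in> subdiff \<phi> u"
    obtain r where r: "\<phi> u = ereal r"
      using v by (rule subdiff_finite)
    have "\<phi> u + ereal (v \<bullet> (u0 - u)) \<le> \<phi> u0"
      using v unfolding subdiff_def by blast
    then have "r + v \<bullet> (u0 - u) \<le> r0"
      by (simp add: r r0)
    moreover have "r0 + v0 \<bullet> (u - u0) + c / 2 * (infdist u (subdiff_inv \<phi> v0))\<^sup>2 \<le> r"
      using growth[OF u] by (simp add: r r0)
    ultimately show "c / 2 * (infdist u (subdiff_inv \<phi> v0))\<^sup>2 \<le> (u - u0) \<bullet> (v - v0)"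
      by (simp add: inner_diff_left inner_diff_right inner_commute)
  qed
qed

text \<open>
  Along a tangent direction the gap divided by the squared step tends to \<open>\<langle>\<omega>, \<eta>\<rangle>\<close>. If this limit is
  zero, the distance to the solution set is of smaller order than the step.
\<close>

lemma quadratic_growth_tangent:
  fixes \<phi> :: "'a::euclidean_space \<Rightarrow> ereal"
  assumes growth: "quadratic_growth \<phi> u0 v0"
    and tan: "(\<omega>, \<eta>) \<in> tangent_cone (gph (subdiff \<phi>)) (u0, v0)"
  shows "0 \<le> \<omega> \<bullet> \<eta>"
    and "\<omega> \<bullet> \<eta> = 0 \<Longrightarrow> \<omega> \<in> tangent_cone (subdiff_inv \<phi> v0) u0"
proof -
  let ?\<Omega> = "subdiff_inv \<phi> v0"
  obtain c \<epsilon> where c: "c > 0" "\<epsilon> > 0"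
    and gap: "\<And>u v. norm (u - u0) < \<epsilon> \<Longrightarrow> v \<in> subdiff \<phi> u \<Longrightarrow>
       c / 2 * (infdist u ?\<Omega>)\<^sup>2 \<le> (u - u0) \<bullet> (v - v0)"
    using growth by (rule quadratic_growth_gap) blast
  obtain t :: "nat \<Rightarrow> real" and W N
    where t: "\<And>k. t k > 0" "t \<longlonglongrightarrow> 0" and W: "W \<longlonglongrightarrow> \<omega>" and N: "N \<longlonglongrightarrow> \<eta>"
      and mem: "\<And>k. v0 + t k *\<^sub>R N k \<in> subdiff \<phi> (u0 + t k *\<^sub>R W k)"
    using tan by (rule tangent_gphE) blast
  define d where "d k = infdist (u0 + t k *\<^sub>R W k) ?\<Omega> / t k" for k
  have "(\<lambda>k. norm (t k *\<^sub>R W k)) \<longlonglongrightarrow> norm (0 *\<^sub>R \<omega>)"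
    by (intro tendsto_intros t W)
  then have "\<forall>\<^sub>F k in sequentially. norm (t k *\<^sub>R W k) < \<epsilon>"
    using c(2) by (intro order_tendstoD(2)) auto
  then have bound: "\<forall>\<^sub>F k in sequentially. c / 2 * (d k)\<^sup>2 \<le> W k \<bullet> N k"
  proof eventually_elim
    case (elim k)
    have "c / 2 * (infdist (u0 + t k *\<^sub>R W k) ?\<Omega>)\<^sup>2 \<le> (t k)\<^sup>2 * (W k \<bullet> N k)"
      using gap[OF _ mem[of k]] elim by (simp add: power2_eq_square mult.assoc)
    moreover have "infdist (u0 + t k *\<^sub>R W k) ?\<Omega> = t k * d k"
      using t(1)[of k] by (simp add: d_def)
    ultimately have "(t k)\<^sup>2 * (c / 2 * (d k)\<^sup>2) \<le> (t k)\<^sup>2 * (W k \<bullet> N k)"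
      by (simp add: power_mult_distrib mult_ac)
    then show ?case
      using t(1)[of k] by (simp only: mult_le_cancel_left_pos zero_less_power)
  qed
  have lim: "(\<lambda>k. W k \<bullet> N k) \<longlonglongrightarrow> \<omega> \<bullet> \<eta>"
    by (intro tendsto_intros W N)
  have "\<forall>\<^sub>F k in sequentially. 0 \<le> W k \<bullet> N k"
    using bound by eventually_elim (use c in \<open>smt (verit) mult_nonneg_nonneg divide_nonneg_nonneg zero_le_power2\<close>)
  then show "0 \<le> \<omega> \<bullet> \<eta>"
    by (intro tendsto_lowerbound[OF lim]) auto
  assume "\<omega> \<bullet> \<eta> = 0"
  with lim have "(\<lambda>k. W k \<bullet> N k) \<longlonglongrightarrow> 0"
    by simp
  then have "(\<lambda>k. c / 2 * (d k)\<^sup>2) \<longlonglongrightarrow> 0"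
    by (intro tendsto_sandwich[OF _ bound tendsto_const]) (use c in auto)
  then have "(\<lambda>k. sqrt (2 / c * (c / 2 * (d k)\<^sup>2))) \<longlonglongrightarrow> sqrt (2 / c * 0)"
    by (intro tendsto_intros)
  moreover have "sqrt (2 / c * (c / 2 * (d k)\<^sup>2)) = d k" for k
    using c t(1)[of k] by (simp add: d_def infdist_nonneg)
  ultimately have "d \<longlonglongrightarrow> 0"
    by simp
  moreover have "u0 \<in> ?\<Omega>"
    using growth by (simp add: quadratic_growth_def subdiff_inv_def)
  ultimately show "\<omega> \<in> tangent_cone ?\<Omega> u0"
    unfolding d_def using t W by (intro tangent_cone_if_infdist[where t = t and \<omega> = W]) auto
qed

section \<open>Gradients and Hessians of convex functions\<close>

text \<open>
  Tangent vectors come with directions that vary along the sequence. A Frechet derivative is uniform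
  over directions, so it still gives the limit of the difference quotients.
\<close>

lemma has_derivative_tangential_quotient:
  fixes F :: "'a::real_normed_vector \<Rightarrow> 'b::real_normed_vector"
  assumes F: "(F has_derivative D) (at x)"
    and t: "\<And>k::nat. t k > 0" "t \<longlonglongrightarrow> 0" and \<omega>: "\<omega> \<longlonglongrightarrow> w"
  shows "(\<lambda>k. (F (x + t k *\<^sub>R \<omega> k) - F x) /\<^sub>R t k) \<longlonglongrightarrow> D w"
proof -
  interpret D: bounded_linear D
    using F by (rule has_derivative_bounded_linear)
  define q where "q = (\<lambda>y. norm (F y - F x - D (y - x)) / norm (y - x))"
  have "(q \<longlongrightarrow> q x) (at x)"
    using F by (simp add: has_derivative_iff_norm q_def)
  then have "isCont q x"
    by (simp add: isCont_def)
  moreover have "(\<lambda>k. x + t k *\<^sub>R \<omega> k) \<longlonglongrightarrow> x + 0 *\<^sub>R w"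
    by (intro tendsto_intros t \<omega>)
  ultimately have "(\<lambda>k. q (x + t k *\<^sub>R \<omega> k)) \<longlonglongrightarrow> q x"
    by (intro isCont_tendsto_compose[where g = q]) auto
  then have "(\<lambda>k. q (x + t k *\<^sub>R \<omega> k) * norm (\<omega> k)) \<longlonglongrightarrow> 0 * norm w"
    by (intro tendsto_mult tendsto_norm \<omega>) (simp add: q_def)
  moreover have "norm ((F (x + t k *\<^sub>R \<omega> k) - F x) /\<^sub>R t k - D (\<omega> k))
      = q (x + t k *\<^sub>R \<omega> k) * norm (\<omega> k)" for k
  proof -
    have "(F (x + t k *\<^sub>R \<omega> k) - F x) /\<^sub>R t k - D (\<omega> k)
        = (F (x + t k *\<^sub>R \<omega> k) - F x - D (t k *\<^sub>R \<omega> k)) /\<^sub>R t k"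
      using t(1)[of k] by (simp add: D.scaleR scaleR_right_diff_distrib)
    then show ?thesis
      using t(1)[of k] by (cases "\<omega> k = 0") (auto simp: q_def divide_simps D.zero)
  qed
  ultimately have "(\<lambda>k. (F (x + t k *\<^sub>R \<omega> k) - F x) /\<^sub>R t k - D (\<omega> k)) \<longlonglongrightarrow> 0"
    by (subst tendsto_norm_zero_iff[symmetric]) simp
  from tendsto_add[OF this D.tendsto[OF \<omega>]] show ?thesis
    by simp
qed

lemma convex_on_above_gradient:
  fixes F :: "'a::real_inner \<Rightarrow> real"
  assumes "convex_on UNIV F" "GDERIV F x :> g"
  shows "F x + g \<bullet> (y - x) \<le> F y"
proof -
  define \<phi> where "\<phi> s = F (x + s *\<^sub>R (y - x))" for s :: real
  have convex: "convex_on UNIV \<phi>"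
  proof (rule convex_onI)
    fix s a b :: real
    assume s: "0 < s" "s < 1"
    have "x + ((1 - s) *\<^sub>R a + s *\<^sub>R b) *\<^sub>R (y - x)
        = (1 - s) *\<^sub>R (x + a *\<^sub>R (y - x)) + s *\<^sub>R (x + b *\<^sub>R (y - x))"
      by (simp add: algebra_simps)
    then show "\<phi> ((1 - s) *\<^sub>R a + s *\<^sub>R b) \<le> (1 - s) * \<phi> a + s * \<phi> b"
      unfolding \<phi>_def using convex_onD[OF assms(1), of s] s by simp
  qed simp
  have deriv: "(\<phi> has_field_derivative g \<bullet> (y - x)) (at 0)"
  proof -
    have "(F has_derivative (\<lambda>h. h \<bullet> g)) (at (x + 0 *\<^sub>R (y - x)))"
      using assms(2) by (simp add: gderiv_def)
    moreover have "((\<lambda>s. x + s *\<^sub>R (y - x)) has_derivative (\<lambda>s. s *\<^sub>R (y - x))) (at 0)"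
      by (auto intro!: derivative_eq_intros)
    ultimately have "(\<phi> has_derivative (\<lambda>s. (s *\<^sub>R (y - x)) \<bullet> g)) (at 0)"
      unfolding \<phi>_def by (rule has_derivative_compose[rotated])
    moreover have "(\<lambda>s. (s *\<^sub>R (y - x)) \<bullet> g) = (*) (g \<bullet> (y - x))"
      by (rule ext) (simp add: inner_commute[of g])
    ultimately show ?thesis
      by (simp only: has_field_derivative_def)
  qed
  have "\<phi> 1 - \<phi> 0 \<ge> g \<bullet> (y - x) * (1 - 0)"
    by (rule convex_on_imp_above_tangent[OF convex connected_UNIV _ _ deriv]) simp_all
  then show ?thesis
    by (simp add: \<phi>_def)
qed

text \<open>
  The gradient of a convex function is cyclically monotone. Applied to the three points \<open>x\<close>,
  \<open>x + t a\<close>, \<open>x + t b\<close> and divided by \<open>t\<^sup>2\<close>, this inequality has the one below as its limit. It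
  gives positive semidefiniteness (\<open>b = 0\<close>) and also the statement about kernels that one
  usually draws from the symmetry of \<open>A\<close>.
\<close>

lemma convex_hessian_cyclic:
  fixes F :: "'a::real_inner \<Rightarrow> real"
  assumes convex: "convex_on UNIV F" and grad: "\<And>x. GDERIV F x :> G x"
    and A: "(G has_derivative A) (at x)"
  shows "A a \<bullet> b \<le> A a \<bullet> a + A b \<bullet> b"
proof -
  define t where "t k = inverse (real (Suc k))" for k
  have t: "t k > 0" "t \<longlonglongrightarrow> 0" for k
    using LIMSEQ_inverse_real_of_nat unfolding t_def by auto
  define Q where "Q w k = (G (x + t k *\<^sub>R w) - G x) /\<^sub>R t k" for w k
  have G: "G (x + t k *\<^sub>R w) = G x + t k *\<^sub>R Q w k" for w k
    using t(1)[of k] by (simp add: Q_def)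
  have Q: "Q w \<longlonglongrightarrow> A w" for w
    unfolding Q_def by (rule has_derivative_tangential_quotient[OF A t tendsto_const])
  have "Q a k \<bullet> b \<le> Q a k \<bullet> a + Q b k \<bullet> b" for k
  proof -
    let ?a = "x + t k *\<^sub>R a" and ?b = "x + t k *\<^sub>R b"
    have "F x + G x \<bullet> (?a - x) \<le> F ?a" "F ?a + G ?a \<bullet> (?b - ?a) \<le> F ?b"
      "F ?b + G ?b \<bullet> (x - ?b) \<le> F x"
      using convex_on_above_gradient[OF convex grad] by blast+
    then have "G x \<bullet> (?a - x) + G ?a \<bullet> (?b - ?a) + G ?b \<bullet> (x - ?b) \<le> 0"
      by linarith
    then have "t k * (t k * (Q a k \<bullet> b)) \<le> t k * (t k * (Q a k \<bullet> a + Q b k \<bullet> b))"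
      unfolding G by (simp add: inner_add_left inner_add_right inner_diff_right algebra_simps)
    then show ?thesis
      using t(1)[of k] by (simp only: mult_le_cancel_left_pos)
  qed
  moreover have "(\<lambda>k. Q a k \<bullet> b) \<longlonglongrightarrow> A a \<bullet> b" "(\<lambda>k. Q a k \<bullet> a + Q b k \<bullet> b) \<longlonglongrightarrow> A a \<bullet> a + A b \<bullet> b"
    by (intro tendsto_intros Q)+
  ultimately show ?thesis
    by (intro LIMSEQ_le) auto
qed

lemma convex_hessian_nonneg:
  fixes F :: "'a::real_inner \<Rightarrow> real"
  assumes "convex_on UNIV F" "\<And>x. GDERIV F x :> G x" "(G has_derivative A) (at x)"
  shows "0 \<le> A a \<bullet> a"
  using convex_hessian_cyclic[OF assms, of a 0] has_derivative_linear[OF assms(3)]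
  by (simp add: linear_0)

text \<open>
  With \<open>b = s A a\<close> the cyclic inequality reads \<open>s |A a|\<^sup>2 \<le> s\<^sup>2 \<langle>A (A a), A a\<rangle>\<close>, which fails for
  small \<open>s > 0\<close> unless \<open>A a = 0\<close>.
\<close>

lemma convex_hessian_kernel:
  fixes F :: "'a::real_inner \<Rightarrow> real"
  assumes "convex_on UNIV F" "\<And>x. GDERIV F x :> G x" "(G has_derivative A) (at x)"
    and a: "A a \<bullet> a = 0"
  shows "A a = 0"
proof -
  define q where "q = A (A a) \<bullet> A a"
  have lin: "linear A"
    using assms(3) by (rule has_derivative_linear)
  have q: "0 \<le> q"
    unfolding q_def by (rule convex_hessian_nonneg[OF assms(1-3)])
  have ineq: "A a \<bullet> A a \<le> s * q" if "s > 0" for s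
  proof -
    have "s * (A a \<bullet> A a) \<le> s * (s * q)"
      using convex_hessian_cyclic[OF assms(1-3), of a "s *\<^sub>R A a"] a lin
      by (simp add: linear_scale q_def)
    then show ?thesis
      using that by (simp only: mult_le_cancel_left_pos)
  qed
  have "A a \<bullet> A a \<le> 0 + e" if "e > 0" for e
  proof -
    have "e / (q + 1) * q \<le> e"
      using that q by (simp add: divide_simps)
    with ineq[of "e / (q + 1)"] that q show ?thesis
      by simp
  qed
  then have "A a \<bullet> A a \<le> 0"
    by (rule field_le_epsilon)
  then show ?thesis
    by (metis antisym inner_eq_zero_iff inner_ge_zero)
qed

lemma gradient_eq:
  assumes "GDERIV h x :> D"
  shows "gradient h x = D"
  unfolding gradient_def
proof (rule the_equality[where P = "\<lambda>D. GDERIV h x :> D"])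
  fix D' assume "GDERIV h x :> D'"
  then have "(\<lambda>h. h \<bullet> D') = (\<lambda>h. h \<bullet> D)"
    using assms has_derivative_unique unfolding gderiv_def by blast
  then show "D' = D"
    by (metis inner_commute vector_eq_ldot)
qed (rule assms)

text \<open>
  The partial gradient is the first component of the full gradient. Its joint derivative
  restricts to the Hessian \<open>hess_xx\<close> on vectors with zero parameter component.
\<close>

lemma twice_cont_differentiable_partial:
  fixes f :: "'x::euclidean_space \<times> 'p::euclidean_space \<Rightarrow> real"
  assumes "twice_cont_differentiable f"
  shows "GDERIV (\<lambda>x. f (x, p)) x :> grad_x f x p"
    and "\<exists>D. ((\<lambda>z. grad_x f (fst z) (snd z)) has_derivative D) (at (x, p)) \<and>
           ((\<lambda>x. grad_x f x p) has_derivative hess_xx f x p) (at x) \<and>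
           (\<forall>h. D (h, 0) = hess_xx f x p h)"
proof -
  obtain G :: "'x \<times> 'p \<Rightarrow> 'x \<times> 'p" and H :: "'x \<times> 'p \<Rightarrow> ('x \<times> 'p) \<Rightarrow>\<^sub>L ('x \<times> 'p)"
    where G: "\<And>z. GDERIV f z :> G z" and H: "\<And>z. (G has_derivative blinfun_apply (H z)) (at z)"
    using assms unfolding twice_cont_differentiable_def by blast
  have emb: "((\<lambda>x. (x, p)) has_derivative (\<lambda>h. (h, 0))) (at x)" for x :: 'x and p :: 'p
    by (auto intro!: derivative_eq_intros)
  have partial: "GDERIV (\<lambda>x. f (x, p)) x :> fst (G (x, p))" for x p
  proof -
    have "((\<lambda>x. f (x, p)) has_derivative (\<lambda>h. (h, 0) \<bullet> G (x, p))) (at x)"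
      by (rule has_derivative_compose[OF emb]) (use G in \<open>simp add: gderiv_def\<close>)
    then show ?thesis
      unfolding gderiv_def by (simp add: inner_prod_def)
  qed
  then have grad: "grad_x f x p = fst (G (x, p))" for x p
    unfolding grad_x_def by (rule gradient_eq)
  show "GDERIV (\<lambda>x. f (x, p)) x :> grad_x f x p"
    unfolding grad by (rule partial)
  have D: "((\<lambda>z. grad_x f (fst z) (snd z)) has_derivative (\<lambda>h. fst (H (x, p) h))) (at (x, p))"
    unfolding grad by (simp, rule has_derivative_fst, rule H)
  have hx: "((\<lambda>x. grad_x f x p) has_derivative (\<lambda>h. fst (H (x, p) (h, 0)))) (at x)"
    using has_derivative_compose[OF emb[of p x] D] by simp
  then have "hess_xx f x p = (\<lambda>h. fst (H (x, p) (h, 0)))"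
    unfolding hess_xx_def by (rule frechet_derivative_at[symmetric])
  with D hx show "\<exists>D. ((\<lambda>z. grad_x f (fst z) (snd z)) has_derivative D) (at (x, p)) \<and>
           ((\<lambda>x. grad_x f x p) has_derivative hess_xx f x p) (at x) \<and>
           (\<forall>h. D (h, 0) = hess_xx f x p h)"
    by (intro exI[of _ "\<lambda>h. fst (H (x, p) h)"]) simp
qed

section \<open>Tangent vectors to the graphs of the solution maps\<close>

lemma mem_translate_iff:
  fixes a v :: "'a::ab_group_add"
  shows "v \<in> {- a + z | z. z \<in> D} \<longleftrightarrow> v + a \<in> D"
proof
  assume "v + a \<in> D"
  moreover have "v = - a + (v + a)"
    by simp
  ultimately show "v \<in> {- a + z | z. z \<in> D}"
    by blast
qed auto

lemma S_hat_iff: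
  "(x, y) \<in> S_hat f K g x0 p0 (u, v) \<longleftrightarrow>
     u = grad_x f x0 p0 + hess_xx f x0 p0 (x - x0) + adjoint K y \<and>
     v + K x \<in> subdiff (fenchel_conjugate g) y"
  using mem_translate_iff[of v "K x" "subdiff (fenchel_conjugate g) y"]
  unfolding S_hat_def by simp

lemma S_tilde_iff:
  "(x, y) \<in> S_tilde f K g (p, v) \<longleftrightarrow>
     0 = grad_x f x p + adjoint K y \<and> v + K x \<in> subdiff (fenchel_conjugate g) y"
  using mem_translate_iff[of v "K x" "subdiff (fenchel_conjugate g) y"]
  unfolding S_tilde_def by simp

lemma tangent_S_hat:
  fixes K :: "'x::euclidean_space \<Rightarrow> 'y::euclidean_space"
    and f :: "'x \<times> 'p::euclidean_space \<Rightarrow> real"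
  assumes K: "linear K" and hess: "linear (hess_xx f x0 p0)"
    and g: "proper_fun g" "lsc_fun g" "convex_fun g"
    and stat: "grad_x f x0 p0 + adjoint K y0 = 0"
    and tan: "((0, 0), (\<xi>, \<eta>)) \<in> tangent_cone (gph (S_hat f K g x0 p0)) ((0, 0), (x0, y0))"
  shows "hess_xx f x0 p0 \<xi> + adjoint K \<eta> = 0"
    and "(K \<xi>, \<eta>) \<in> tangent_cone (gph (subdiff g)) (K x0, y0)"
proof -
  let ?A = "hess_xx f x0 p0"
  have lin: "bounded_linear K" "bounded_linear (adjoint K)" "bounded_linear ?A"
    using K hess by (auto simp: linear_conv_bounded_linear[symmetric] adjoint_linear)
  obtain t :: "nat \<Rightarrow> real" and \<alpha> \<zeta>
    where t: "\<And>k. t k > 0" "t \<longlonglongrightarrow> 0" and \<alpha>: "\<alpha> \<longlonglongrightarrow> (0, 0)" and \<zeta>: "\<zeta> \<longlonglongrightarrow> (\<xi>, \<eta>)"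
      and mem: "\<And>k. (x0, y0) + t k *\<^sub>R \<zeta> k \<in> S_hat f K g x0 p0 ((0, 0) + t k *\<^sub>R \<alpha> k)"
    using tan by (rule tangent_gphE) blast
  define \<mu> \<nu> X Y where "\<mu> k = fst (\<alpha> k)" and "\<nu> k = snd (\<alpha> k)"
    and "X k = fst (\<zeta> k)" and "Y k = snd (\<zeta> k)" for k
  have lims: "\<mu> \<longlonglongrightarrow> 0" "\<nu> \<longlonglongrightarrow> 0" "X \<longlonglongrightarrow> \<xi>" "Y \<longlonglongrightarrow> \<eta>"
    using tendsto_fst[OF \<alpha>] tendsto_snd[OF \<alpha>] tendsto_fst[OF \<zeta>] tendsto_snd[OF \<zeta>]
    unfolding \<mu>_def \<nu>_def X_def Y_def by simp_all
  have "(x0 + t k *\<^sub>R X k, y0 + t k *\<^sub>R Y k) \<in> S_hat f K g x0 p0 (t k *\<^sub>R \<mu> k, t k *\<^sub>R \<nu> k)" for k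
    using mem[of k] by (cases "\<alpha> k"; cases "\<zeta> k") (simp add: \<mu>_def \<nu>_def X_def Y_def)
  then have eq: "t k *\<^sub>R \<mu> k = grad_x f x0 p0 + ?A (t k *\<^sub>R X k) + adjoint K (y0 + t k *\<^sub>R Y k)"
    and sub: "t k *\<^sub>R \<nu> k + K (x0 + t k *\<^sub>R X k) \<in> subdiff (fenchel_conjugate g) (y0 + t k *\<^sub>R Y k)" for k
    by (simp_all add: S_hat_iff)
  have "\<mu> k = ?A (X k) + adjoint K (Y k)" for k
  proof -
    have "t k *\<^sub>R \<mu> k = t k *\<^sub>R (?A (X k) + adjoint K (Y k)) + (grad_x f x0 p0 + adjoint K y0)"
      unfolding eq using hess adjoint_linear[OF K]
      by (simp add: linear_add linear_scale scaleR_add_right)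
    then show ?thesis
      using t(1)[of k] by (simp add: stat)
  qed
  moreover have "(\<lambda>k. ?A (X k) + adjoint K (Y k)) \<longlonglongrightarrow> ?A \<xi> + adjoint K \<eta>"
    by (intro tendsto_add bounded_linear.tendsto[OF lin(3)] bounded_linear.tendsto[OF lin(2)] lims)
  ultimately have "\<mu> \<longlonglongrightarrow> ?A \<xi> + adjoint K \<eta>"
    by presburger
  with lims(1) show "?A \<xi> + adjoint K \<eta> = 0"
    by (rule LIMSEQ_unique[symmetric])
  show "(K \<xi>, \<eta>) \<in> tangent_cone (gph (subdiff g)) (K x0, y0)"
  proof (rule tangent_gphI[OF t])
    have "(\<lambda>k. \<nu> k + K (X k)) \<longlonglongrightarrow> 0 + K \<xi>"
      by (intro tendsto_add bounded_linear.tendsto[OF lin(1)] lims)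
    then show "(\<lambda>k. \<nu> k + K (X k)) \<longlonglongrightarrow> K \<xi>"
      by simp
    show "Y \<longlonglongrightarrow> \<eta>"
      by (rule lims)
    show "y0 + t k *\<^sub>R Y k \<in> subdiff g (K x0 + t k *\<^sub>R (\<nu> k + K (X k)))" for k
      using sub[of k] K unfolding subdiff_conjugate_iff[OF g]
      by (simp add: linear_add linear_scale scaleR_add_right algebra_simps)
  qed
qed

text \<open>
  A point of the graph of \<open>S_tilde\<close> lies in the graph of \<open>S_hat\<close> for the parameter \<open>u\<close> equal to the
  linearization error of the gradient in \<open>x\<close>. Along \<open>(\<xi>, \<eta>)\<close> with parameter direction zero, this
  error divided by the step tends to \<open>A \<xi> - D(\<xi>, 0) = 0\<close>, where \<open>D\<close> is the joint derivative.
\<close>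

lemma tangent_S_tilde_S_hat:
  fixes K :: "'x::euclidean_space \<Rightarrow> 'y::euclidean_space"
    and f :: "'x \<times> 'p::euclidean_space \<Rightarrow> real"
  assumes f: "twice_cont_differentiable f"
    and tan: "((0, 0), (\<xi>, \<eta>)) \<in> tangent_cone (gph (S_tilde f K g)) ((p0, 0), (x0, y0))"
  shows "((0, 0), (\<xi>, \<eta>)) \<in> tangent_cone (gph (S_hat f K g x0 p0)) ((0, 0), (x0, y0))"
proof -
  let ?A = "hess_xx f x0 p0" and ?G = "\<lambda>z. grad_x f (fst z) (snd z)"
  obtain D where D: "(?G has_derivative D) (at (x0, p0))"
    and hess: "((\<lambda>x. grad_x f x p0) has_derivative ?A) (at x0)" and DA: "\<And>h. D (h, 0) = ?A h"
    using twice_cont_differentiable_partial(2)[OF f, of x0 p0] by blast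
  obtain t :: "nat \<Rightarrow> real" and \<alpha> \<zeta>
    where t: "\<And>k. t k > 0" "t \<longlonglongrightarrow> 0" and \<alpha>: "\<alpha> \<longlonglongrightarrow> (0, 0)" and \<zeta>: "\<zeta> \<longlonglongrightarrow> (\<xi>, \<eta>)"
      and mem: "\<And>k. (x0, y0) + t k *\<^sub>R \<zeta> k \<in> S_tilde f K g ((p0, 0) + t k *\<^sub>R \<alpha> k)"
    using tan by (rule tangent_gphE) blast
  define \<pi> \<nu> X Y where "\<pi> k = fst (\<alpha> k)" and "\<nu> k = snd (\<alpha> k)"
    and "X k = fst (\<zeta> k)" and "Y k = snd (\<zeta> k)" for k
  have lims: "\<pi> \<longlonglongrightarrow> 0" "\<nu> \<longlonglongrightarrow> 0" "X \<longlonglongrightarrow> \<xi>" "Y \<longlonglongrightarrow> \<eta>"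
    using tendsto_fst[OF \<alpha>] tendsto_snd[OF \<alpha>] tendsto_fst[OF \<zeta>] tendsto_snd[OF \<zeta>]
    unfolding \<pi>_def \<nu>_def X_def Y_def by simp_all
  have "(x0 + t k *\<^sub>R X k, y0 + t k *\<^sub>R Y k) \<in> S_tilde f K g (p0 + t k *\<^sub>R \<pi> k, t k *\<^sub>R \<nu> k)" for k
    using mem[of k] by (cases "\<alpha> k"; cases "\<zeta> k") (simp add: \<pi>_def \<nu>_def X_def Y_def)
  then have eq: "0 = ?G ((x0, p0) + t k *\<^sub>R (X k, \<pi> k)) + adjoint K (y0 + t k *\<^sub>R Y k)"
    and sub: "t k *\<^sub>R \<nu> k + K (x0 + t k *\<^sub>R X k) \<in> subdiff (fenchel_conjugate g) (y0 + t k *\<^sub>R Y k)" for k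
    by (simp_all add: S_tilde_iff)
  have lin: "linear ?A"
    using hess by (rule has_derivative_linear)
  define R where "R k = (?G ((x0, p0) + t k *\<^sub>R (X k, \<pi> k)) - ?G (x0, p0)) /\<^sub>R t k" for k
  have "R \<longlonglongrightarrow> D (\<xi>, 0)"
    unfolding R_def by (intro has_derivative_tangential_quotient[OF D t] tendsto_Pair lims)
  then have "(\<lambda>k. ?A (X k) - R k) \<longlonglongrightarrow> ?A \<xi> - D (\<xi>, 0)"
    by (intro tendsto_diff bounded_linear.tendsto[OF has_derivative_bounded_linear[OF hess]] lims)
  then have err: "(\<lambda>k. ?A (X k) - R k) \<longlonglongrightarrow> 0"
    by (simp add: DA)
  show ?thesis
  proof (rule tangent_gphI[OF t])
    show "(\<lambda>k. (?A (X k) - R k, \<nu> k)) \<longlonglongrightarrow> (0, 0)" "(\<lambda>k. (X k, Y k)) \<longlonglongrightarrow> (\<xi>, \<eta>)"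
      by (intro tendsto_Pair err lims)+
    show "(x0, y0) + t k *\<^sub>R (X k, Y k) \<in> S_hat f K g x0 p0 ((0, 0) + t k *\<^sub>R (?A (X k) - R k, \<nu> k))" for k
    proof -
      have "t k *\<^sub>R R k = ?G ((x0, p0) + t k *\<^sub>R (X k, \<pi> k)) - grad_x f x0 p0"
        using t(1)[of k] by (simp add: R_def)
      also have "\<dots> = - adjoint K (y0 + t k *\<^sub>R Y k) - grad_x f x0 p0"
        using eq[of k] by (simp add: eq_neg_iff_add_eq_0)
      finally have "t k *\<^sub>R (?A (X k) - R k)
          = grad_x f x0 p0 + ?A (t k *\<^sub>R X k) + adjoint K (y0 + t k *\<^sub>R Y k)"
        using lin by (simp add: scaleR_right_diff_distrib linear_scale)
      then show ?thesis
        using sub[of k] by (simp add: S_hat_iff)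
    qed
  qed
qed

text \<open>
  The two inner products \<open>\<langle>K \<xi>, \<eta>\<rangle> \<ge> 0\<close> (growth) and \<open>\<langle>A \<xi>, \<xi>\<rangle> \<ge> 0\<close> (convexity) add up to zero
  along a tangent direction with zero parameter component, so both vanish and each of the two
  kernel conditions applies.
\<close>

lemma tangent_S_hat_eq_0:
  fixes K :: "'x::euclidean_space \<Rightarrow> 'y::euclidean_space"
    and f :: "'x \<times> 'p::euclidean_space \<Rightarrow> real"
  assumes K: "linear K"
    and f_C2: "twice_cont_differentiable f"
    and f_convex: "convex_on UNIV (\<lambda>x. f (x, p0))"
    and g: "proper_fun g" "lsc_fun g" "convex_fun g"
    and stat: "grad_x f x0 p0 + adjoint K y0 = 0"
    and growth: "primal_dual_quadratic_growth g (K x0) y0"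
    and dual: "{y. adjoint K y = 0} \<inter> tangent_cone (subdiff g (K x0)) y0 = {0}"
    and primal: "{x. hess_xx f x0 p0 x = 0} \<inter>
        K -` tangent_cone (subdiff (fenchel_conjugate g) y0) (K x0) = {0}"
    and tan: "((0, 0), (\<xi>, \<eta>)) \<in> tangent_cone (gph (S_hat f K g x0 p0)) ((0, 0), (x0, y0))"
  shows "\<xi> = 0" "\<eta> = 0"
proof -
  let ?A = "hess_xx f x0 p0"
  have grad: "GDERIV (\<lambda>x. f (x, p0)) x :> grad_x f x p0" for x
    by (rule twice_cont_differentiable_partial(1)[OF f_C2])
  have hess: "((\<lambda>x. grad_x f x p0) has_derivative ?A) (at x0)"
    using twice_cont_differentiable_partial(2)[OF f_C2] by blast
  note tangent = tangent_S_hat[OF K has_derivative_linear[OF hess] g stat tan]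
  have growth_g: "quadratic_growth g (K x0) y0"
    and growth_conj: "quadratic_growth (fenchel_conjugate g) y0 (K x0)"
    using growth unfolding primal_dual_quadratic_growth_def by auto
  have swap: "(\<eta>, K \<xi>) \<in> tangent_cone (gph (subdiff (fenchel_conjugate g))) (y0, K x0)"
    using tangent(2)
    by (rule tangent_gphE, intro tangent_gphI) (auto simp: subdiff_conjugate_iff[OF g])
  have inv: "subdiff_inv g y0 = subdiff (fenchel_conjugate g) y0"
    "subdiff_inv (fenchel_conjugate g) (K x0) = subdiff g (K x0)"
    unfolding subdiff_inv_def by (auto simp: subdiff_conjugate_iff[OF g])
  have "K \<xi> \<bullet> \<eta> = \<xi> \<bullet> adjoint K \<eta>"
    by (simp add: adjoint_works[OF K] inner_commute)
  also have "\<dots> = - (?A \<xi> \<bullet> \<xi>)"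
    using tangent(1) by (simp add: add_eq_0_iff inner_commute)
  finally have sum: "K \<xi> \<bullet> \<eta> + ?A \<xi> \<bullet> \<xi> = 0"
    by simp
  moreover have "0 \<le> K \<xi> \<bullet> \<eta>"
    by (rule quadratic_growth_tangent(1)[OF growth_g tangent(2)])
  moreover have "0 \<le> ?A \<xi> \<bullet> \<xi>"
    by (rule convex_hessian_nonneg[OF f_convex grad hess])
  ultimately have zero: "K \<xi> \<bullet> \<eta> = 0" "?A \<xi> \<bullet> \<xi> = 0"
    by linarith+
  have A: "?A \<xi> = 0"
    by (rule convex_hessian_kernel[OF f_convex grad hess zero(2)])
  with quadratic_growth_tangent(2)[OF growth_g tangent(2) zero(1)] primal show "\<xi> = 0"
    unfolding inv by auto
  have "adjoint K \<eta> = 0"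
    using A tangent(1) by simp
  moreover have "\<eta> \<in> tangent_cone (subdiff g (K x0)) y0"
    using quadratic_growth_tangent(2)[OF growth_conj swap] zero(1)
    unfolding inv by (simp add: inner_commute)
  ultimately show "\<eta> = 0"
    using dual by auto
qed

section \<open>The characterization of isolated calmness\<close>

theorem theorem4p8:
  fixes K :: "'x::euclidean_space \<Rightarrow> 'y::euclidean_space"
    and f :: "'x \<times> 'p::euclidean_space \<Rightarrow> real"
    and g :: "'y \<Rightarrow> ereal"
    and x0 :: 'x and y0 :: 'y and p0 :: 'p
  assumes K: "linear K"
    and f_C2: "twice_cont_differentiable f"
    and f_convex: "\<And>p. convex_on UNIV (\<lambda>x. f (x, p))"
    and g: "proper_fun g" "lsc_fun g" "convex_fun g"
    and sol: "(x0, y0) \<in> S_tilde f K g (p0, 0)"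
    and rcq: "robinson_cq K g x0"
  defines "star \<equiv>
      {y. adjoint K y = 0} \<inter> tangent_cone (subdiff g (K x0)) y0 = {0} \<and>
      {x. hess_xx f x0 p0 x = 0} \<inter>
        K -` tangent_cone (subdiff (fenchel_conjugate g) y0) (K x0) = {0}"
  shows "(isolated_calm (S_hat f K g x0 p0) (0, 0) (x0, y0) \<longrightarrow> star) \<and>
         (primal_dual_quadratic_growth g (K x0) y0 \<longrightarrow> star \<longrightarrow>
            isolated_calm (S_hat f K g x0 p0) (0, 0) (x0, y0)) \<and>
         (primal_dual_quadratic_growth g (K x0) y0 \<longrightarrow> star \<longrightarrow>
            isolated_calm (S_tilde f K g) (p0, 0) (x0, y0))"
proof -
  let ?A = "hess_xx f x0 p0" and ?gs = "fenchel_conjugate g"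
  have stat: "grad_x f x0 p0 + adjoint K y0 = 0" and Kx0: "K x0 \<in> subdiff ?gs y0"
    using sol by (simp_all add: S_tilde_iff)
  have y0: "y0 \<in> subdiff g (K x0)"
    using Kx0 by (simp add: subdiff_conjugate_iff[OF g])
  have hess: "((\<lambda>x. grad_x f x p0) has_derivative ?A) (at x0)"
    using twice_cont_differentiable_partial(2)[OF f_C2] by blast
  have linA: "linear ?A"
    using hess by (rule has_derivative_linear)
  have linK': "linear (adjoint K)"
    by (rule adjoint_linear[OF K])
  have sol_hat: "(x0, y0) \<in> S_hat f K g x0 p0 (0, 0)"
    using stat Kx0 by (simp add: S_hat_iff linear_0[OF linA])

  have necessary: star if calm: "isolated_calm (S_hat f K g x0 p0) (0, 0) (x0, y0)"
    unfolding star_def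
  proof (intro conjI equalityI subsetI; clarsimp)
    fix \<eta> assume \<eta>: "adjoint K \<eta> = 0" "\<eta> \<in> tangent_cone (subdiff g (K x0)) y0"
    obtain t :: "nat \<Rightarrow> real" and Y where t: "\<And>k. t k > 0" "t \<longlonglongrightarrow> 0" and Y: "Y \<longlonglongrightarrow> \<eta>"
      and mem: "\<And>k. y0 + t k *\<^sub>R Y k \<in> subdiff g (K x0)"
      using \<eta>(2) by (rule tangent_coneE) blast
    have "((0, 0), (0, \<eta>)) \<in> tangent_cone (gph (S_hat f K g x0 p0)) ((0, 0), (x0, y0))"
    proof (rule tangent_gphI[OF t])
      have "(\<lambda>k. adjoint K (Y k)) \<longlonglongrightarrow> adjoint K \<eta>"
        using linK' Y by (simp add: linear_conv_bounded_linear bounded_linear.tendsto)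
      then show "(\<lambda>k. (adjoint K (Y k), 0)) \<longlonglongrightarrow> (0, 0)"
        by (intro tendsto_Pair tendsto_const) (simp add: \<eta>(1))
      show "(\<lambda>k. (0, Y k)) \<longlonglongrightarrow> (0, \<eta>)"
        by (intro tendsto_Pair tendsto_const Y)
      show "(x0, y0) + t k *\<^sub>R (0, Y k) \<in> S_hat f K g x0 p0 ((0, 0) + t k *\<^sub>R (adjoint K (Y k), 0))" for k
        using mem[of k] stat linK'
        by (simp add: S_hat_iff subdiff_conjugate_iff[OF g] linear_0[OF linA] linear_add linear_scale
            add.assoc[symmetric])
    qed
    with isolated_calm_tangent_eq_0[OF calm, of "(0, \<eta>)"] show "\<eta> = 0"
      by (simp add: zero_prod_def)
  next
    show "adjoint K 0 = 0 \<and> 0 \<in> tangent_cone (subdiff g (K x0)) y0"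
      using linear_0[OF linK'] zero_in_tangent_cone[OF y0] by simp
  next
    fix \<xi> assume \<xi>: "?A \<xi> = 0" "K \<xi> \<in> tangent_cone (subdiff ?gs y0) (K x0)"
    obtain t :: "nat \<Rightarrow> real" and Z where t: "\<And>k. t k > 0" "t \<longlonglongrightarrow> 0" and Z: "Z \<longlonglongrightarrow> K \<xi>"
      and mem: "\<And>k. K x0 + t k *\<^sub>R Z k \<in> subdiff ?gs y0"
      using \<xi>(2) by (rule tangent_coneE) blast
    have "((0, 0), (\<xi>, 0)) \<in> tangent_cone (gph (S_hat f K g x0 p0)) ((0, 0), (x0, y0))"
    proof (rule tangent_gphI[OF t])
      have "(\<lambda>k. Z k - K \<xi>) \<longlonglongrightarrow> K \<xi> - K \<xi>"
        by (intro tendsto_intros Z)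
      then show "(\<lambda>k. (0, Z k - K \<xi>)) \<longlonglongrightarrow> (0, 0)"
        by (intro tendsto_Pair tendsto_const) simp
      show "(\<lambda>k. (\<xi>, 0)) \<longlonglongrightarrow> (\<xi>, 0)"
        by (rule tendsto_const)
      show "(x0, y0) + t k *\<^sub>R (\<xi>, 0) \<in> S_hat f K g x0 p0 ((0, 0) + t k *\<^sub>R (0, Z k - K \<xi>))" for k
        using mem[of k] stat \<xi>(1) K linA
        by (simp add: S_hat_iff linear_add linear_scale algebra_simps)
    qed
    with isolated_calm_tangent_eq_0[OF calm, of "(\<xi>, 0)"] show "\<xi> = 0"
      by (simp add: zero_prod_def)
  next
    show "?A 0 = 0 \<and> K 0 \<in> tangent_cone (subdiff ?gs y0) (K x0)"
      using linear_0[OF linA] linear_0[OF K] zero_in_tangent_cone[OF Kx0] by simp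
  qed

  have directions: "\<zeta> = 0"
    if "primal_dual_quadratic_growth g (K x0) y0" star
      "(0, \<zeta>) \<in> tangent_cone (gph (S_hat f K g x0 p0)) ((0, 0), (x0, y0))" for \<zeta>
    using tangent_S_hat_eq_0[OF K f_C2 f_convex g stat that(1), of "fst \<zeta>" "snd \<zeta>"] that(2,3)
    unfolding star_def by (simp add: zero_prod_def prod_eq_iff)

  have "isolated_calm (S_hat f K g x0 p0) (0, 0) (x0, y0)"
    if "primal_dual_quadratic_growth g (K x0) y0" star
    using directions[OF that] sol_hat by (intro isolated_calm_if_tangent)
  moreover have "isolated_calm (S_tilde f K g) (p0, 0) (x0, y0)"
    if "primal_dual_quadratic_growth g (K x0) y0" star
  proof (rule isolated_calm_if_tangent, rule sol)
    fix \<zeta> assume "(0, \<zeta>) \<in> tangent_cone (gph (S_tilde f K g)) ((p0, 0), (x0, y0))"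
    then have "(0, \<zeta>) \<in> tangent_cone (gph (S_hat f K g x0 p0)) ((0, 0), (x0, y0))"
      using tangent_S_tilde_S_hat[OF f_C2, of "fst \<zeta>" "snd \<zeta>"] by (simp add: zero_prod_def)
    then show "\<zeta> = 0"
      by (rule directions[OF that])
  qed
  ultimately show ?thesis
    using necessary by blast
qed

end
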